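(* Let $\overline{G}$ be a geometric graph with underlying abstract graph $G$. If all pairs of (distinct) crossings in $\overline{G}$ are at distance at least $2$, then $X(\overline{G}) \le \chi(G) + 2$.
   Context: Graphs are finite and simple. A geometric graph $\overline{G}$ is a simple graph $G$ drawn in the plane with vertices at distinct points in general position (no three collinear) and edges drawn as straight line segments. Two edges with no common endpoint cross if their segments intersect; a crossing of $\overline{G}$ is a pair of edges that cross, and the vertices of a crossing are the four endpoints of its two edges. The distance between two crossings is the minimum graph distance in $G$ between a vertex of the first crossing and a vertex of the second (it is $\infty$ if no such vertices are joined by a path). A geometric homomorphism $f:\overline{G}\to\overline{H}$ between geometric graphs is a map of vertex sets that sends adjacent vertices to adjacent vertices and sends each pair of crossing edges of $\overline{G}$ to a pair of crossing edges of $\overline{H}$. A geometric $n$-clique $\overline{K}_n$ is any geometric graph whose underlying abstract graph is the complete graph $K_n$. The geochromatic number $X(\overline{G})$ is the smallest positive integer $n$ such that there is a geometric homomorphism $\overline{G}\to\overline{K}_n$ for some geometric $n$-clique $\overline{K}_n$. $\chi(G)$ is the ordinary chromatic number of $G$. *)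

theory Defs
  imports "HOL-Analysis.Analysis" "HOL-Library.Extended_Nat"
begin

record 'a graph =
  verts :: "'a set"
  edges :: "'a set set"

record 'a geom_graph = "'a graph" +
  point :: "'a \<Rightarrow> real^2"

definition simple_graph :: "('a, 'b) graph_scheme \<Rightarrow> bool" where
  "simple_graph G \<longleftrightarrow> finite (verts G) \<and> (\<forall>e\<in>edges G. e \<subseteq> verts G \<and> card e = 2)"

definition geometric_graph :: "'a geom_graph \<Rightarrow> bool" where
  "geometric_graph G \<longleftrightarrow>
     simple_graph G \<and> inj_on (point G) (verts G) \<and>
     (\<forall>u\<in>verts G. \<forall>v\<in>verts G. \<forall>w\<in>verts G.
        u \<noteq> v \<and> v \<noteq> w \<and> u \<noteq> w \<longrightarrow> \<not> collinear {point G u, point G v, point G w})"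

(* The convex hull of the two points of an edge is the segment joining them
   (segment_convex_hull). *)
definition edge_segment :: "'a geom_graph \<Rightarrow> 'a set \<Rightarrow> (real^2) set" where
  "edge_segment G e = convex hull (point G ` e)"

definition crosses :: "'a geom_graph \<Rightarrow> 'a set \<Rightarrow> 'a set \<Rightarrow> bool" where
  "crosses G e e' \<longleftrightarrow>
     e \<in> edges G \<and> e' \<in> edges G \<and> e \<inter> e' = {} \<and> edge_segment G e \<inter> edge_segment G e' \<noteq> {}"

(* A crossing is an unordered pair {e, e'} of edges, so its vertices are the union of
   the set. *)
definition crossings :: "'a geom_graph \<Rightarrow> 'a set set set" where
  "crossings G = {{e, e'} |e e'. crosses G e e'}"

definition adj_rel :: "('a, 'b) graph_scheme \<Rightarrow> 'a rel" where
  "adj_rel G = {(u, v). {u, v} \<in> edges G}"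

(* Length of a shortest walk; the infimum of the empty set is \<infinity>. *)
definition graph_dist :: "('a, 'b) graph_scheme \<Rightarrow> 'a \<Rightarrow> 'a \<Rightarrow> enat" where
  "graph_dist G u v = (INF n\<in>{n. (u, v) \<in> adj_rel G ^^ n}. enat n)"

definition crossing_dist :: "'a geom_graph \<Rightarrow> 'a set set \<Rightarrow> 'a set set \<Rightarrow> enat" where
  "crossing_dist G c d = (INF u\<in>\<Union>c. INF v\<in>\<Union>d. graph_dist G u v)"

definition geometric_hom :: "'a geom_graph \<Rightarrow> 'b geom_graph \<Rightarrow> ('a \<Rightarrow> 'b) \<Rightarrow> bool" where
  "geometric_hom G H f \<longleftrightarrow>
     f ` verts G \<subseteq> verts H \<and>
     (\<forall>u v. {u, v} \<in> edges G \<longrightarrow> {f u, f v} \<in> edges H) \<and>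
     (\<forall>e e'. crosses G e e' \<longrightarrow> crosses H (f ` e) (f ` e'))"

definition geometric_clique :: "nat \<Rightarrow> 'a geom_graph \<Rightarrow> bool" where
  "geometric_clique n K \<longleftrightarrow>
     geometric_graph K \<and> card (verts K) = n \<and>
     edges K = {{u, v} |u v. u \<in> verts K \<and> v \<in> verts K \<and> u \<noteq> v}"

(* Every finite geometric graph is isomorphic to one with vertices in nat, so this vertex
   type covers all geometric cliques. The set of admissible n is nonempty: adding all
   missing edges to G gives a clique (if G has no vertices, n = 1 is admissible). *)
definition geochromatic_number :: "'a geom_graph \<Rightarrow> nat" where
  "geochromatic_number G =
     (LEAST n. n > 0 \<and> (\<exists>(K :: nat geom_graph) f. geometric_clique n K \<and> geometric_hom G K f))"

definition chromatic_number :: "('a, 'b) graph_scheme \<Rightarrow> nat" where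
  "chromatic_number G =
     (LEAST k. \<exists>c :: 'a \<Rightarrow> nat. c ` verts G \<subseteq> {..<k} \<and>
        (\<forall>u v. {u, v} \<in> edges G \<longrightarrow> c u \<noteq> c v))"

end

theory Submission
  imports Defs
begin

text \<open>
  Start from an optimal proper colouring \<open>c\<close> with colours \<open>0, \<dots>, k - 1\<close>. In a crossing of the
  edges \<open>{a, b}\<close> and \<open>{p, q}\<close> both edges are bicoloured, so an endpoint of one and an endpoint of
  the other have different colours; name them so that \<open>c b < c q\<close>. Give \<open>a\<close> a new colour \<open>A\<close> and
  \<open>p\<close> a new colour \<open>B\<close>, and do so in all crossings at once. Different crossings are at distance at
  least 2, so each vertex lies in at most one crossing and no two vertices of the same new colour
  are adjacent. The new colouring is therefore still proper, that is, a homomorphism of abstract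
  graphs to the complete graph on \<open>k + 2\<close> colours.

  The images of the two crossing edges are \<open>{A, c b}\<close> and \<open>{B, c q}\<close> with \<open>c b < c q\<close>. Place the
  \<open>k + 2\<close> colours in convex position in the cyclic order \<open>A, B, 0, \<dots>, k - 1\<close>. Then these two chords
  have interleaving endpoints and hence cross, whatever the two old colours are. The points of
  the parabola \<open>y = x\<^sup>2\<close> with abscissae \<open>0, \<dots>, k + 1\<close> serve as the convex position, so that \<open>A\<close>
  is 0, \<open>B\<close> is 1 and the old colour \<open>i\<close> is \<open>i + 2\<close>.
\<close>

section \<open>Cliques in convex position\<close>

definition parabola :: "real \<Rightarrow> real^2" where
  "parabola t = vector [t, t\<^sup>2]"

lemma parabola_nth [simp]: "parabola t $ 1 = t" "parabola t $ 2 = t\<^sup>2"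
  by (simp_all add: parabola_def)

text \<open>The chord over \<open>[a, b]\<close> has slope \<open>a + b\<close>, so two chords from one point are never parallel.\<close>

lemma parabola_not_collinear:
  assumes "a \<noteq> b" "b \<noteq> d" "a \<noteq> d"
  shows "\<not> collinear {parabola a, parabola b, parabola d}"
proof
  assume "collinear {parabola a, parabola b, parabola d}"
  then obtain u where "\<forall>x\<in>{parabola a, parabola b, parabola d}.
      \<forall>y\<in>{parabola a, parabola b, parabola d}. \<exists>r. x - y = r *\<^sub>R u"
    unfolding collinear_def by blast
  then obtain r s where r: "parabola b - parabola a = r *\<^sub>R u"
    and s: "parabola d - parabola a = s *\<^sub>R u"
    by blast
  have r1: "b - a = r * u $ 1" and r2: "b\<^sup>2 - a\<^sup>2 = r * u $ 2"
    using r by (simp_all add: vec_eq_iff forall_2)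
  have s1: "d - a = s * u $ 1" and s2: "d\<^sup>2 - a\<^sup>2 = s * u $ 2"
    using s by (simp_all add: vec_eq_iff forall_2)
  have "(b - a) * (d\<^sup>2 - a\<^sup>2) = (d - a) * (b\<^sup>2 - a\<^sup>2)"
    unfolding r1 r2 s1 s2 by (simp add: algebra_simps)
  then have "(b - a) * (d - a) * (d - b) = 0"
    by (simp add: algebra_simps power2_eq_square)
  with assms show False
    by simp
qed

lemma mem_chord_parabola:
  assumes "a < c" "a \<le> x" "x \<le> c"
  shows "vector [x, (a + c) * x - a * c] \<in> closed_segment (parabola a) (parabola c)"
proof -
  define u where "u = (x - a) / (c - a)"
  have u: "0 \<le> u" "u \<le> 1" and x: "x = a + u * (c - a)"
    using assms by (simp_all add: u_def)
  have "vector [x, (a + c) * x - a * c] = (1 - u) *\<^sub>R parabola a + u *\<^sub>R parabola c"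
    unfolding x by (simp add: vec_eq_iff forall_2 algebra_simps power2_eq_square)
  with u show ?thesis
    unfolding closed_segment_def by blast
qed

lemma chords_parabola_intersect:
  assumes "a < b" "b < c" "c < d"
  shows "closed_segment (parabola a) (parabola c) \<inter> closed_segment (parabola b) (parabola d) \<noteq> {}"
proof -
  \<comment> \<open>the abscissa at which the two lines \<open>y = (a + c) x - a c\<close> and \<open>y = (b + d) x - b d\<close> meet\<close>
  define D where "D = b + d - a - c"
  define x where "x = (b * d - a * c) / D"
  have D: "D > 0"
    using assms by (simp add: D_def)
  then have xD: "x * D = b * d - a * c"
    by (simp add: x_def)
  have "(x - b) * D = (b - a) * (c - b)" "(c - x) * D = (c - b) * (d - c)"
    unfolding left_diff_distrib xD by (simp_all add: D_def algebra_simps)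
  then have "(x - b) * D > 0" "(c - x) * D > 0"
    using assms by simp_all
  with D have "b < x" "x < c"
    by (simp_all add: zero_less_mult_iff)
  then have "vector [x, (a + c) * x - a * c] \<in> closed_segment (parabola a) (parabola c)"
    and "vector [x, (b + d) * x - b * d] \<in> closed_segment (parabola b) (parabola d)"
    using assms by (intro mem_chord_parabola; simp)+
  moreover have "(a + c) * x - a * c = (b + d) * x - b * d"
    using xD by (simp add: D_def algebra_simps)
  ultimately show ?thesis
    by auto
qed

definition convex_clique :: "nat \<Rightarrow> nat geom_graph" where
  "convex_clique n = \<lparr>verts = {..<n}, edges = {{i, j} |i j. i < n \<and> j < n \<and> i \<noteq> j},
     point = (\<lambda>i. parabola (real i))\<rparr>"

lemma convex_clique_simps [simp]:
  "verts (convex_clique n) = {..<n}"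
  "edges (convex_clique n) = {{i, j} |i j. i < n \<and> j < n \<and> i \<noteq> j}"
  "point (convex_clique n) i = parabola (real i)"
  by (simp_all add: convex_clique_def)

lemma edges_convex_clique:
  assumes "i < n" "j < n" "i \<noteq> j"
  shows "{i, j} \<in> edges (convex_clique n)"
  using assms unfolding convex_clique_simps by blast

lemma geometric_clique_convex_clique: "geometric_clique n (convex_clique n)"
proof -
  have "inj_on (point (convex_clique n)) {..<n}"
  proof (rule inj_onI)
    fix i j assume "point (convex_clique n) i = point (convex_clique n) j"
    then have "parabola (real i) $ 1 = parabola (real j) $ 1"
      by simp
    then show "i = j"
      by simp
  qed
  then show ?thesis
    by (auto simp: geometric_clique_def geometric_graph_def simple_graph_def
        parabola_not_collinear card_2_iff)
qed

lemma crosses_convex_clique: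
  assumes "h < i" "i < j" "j < l" "l < n"
  shows "crosses (convex_clique n) {h, j} {i, l}"
proof -
  have "{h, j} \<in> edges (convex_clique n)" "{i, l} \<in> edges (convex_clique n)"
    using assms edges_convex_clique[of h n j] edges_convex_clique[of i n l] by simp_all
  then show ?thesis
    using assms chords_parabola_intersect[of "real h" "real i" "real j" "real l"]
    by (simp add: crosses_def edge_segment_def segment_convex_hull)
qed

lemma crosses_commute: "crosses G e e' \<longleftrightarrow> crosses G e' e"
  by (auto simp: crosses_def)

section \<open>Vertices of distant crossings\<close>

lemma graph_dist_le:
  assumes "(u, v) \<in> adj_rel G ^^ n"
  shows "graph_dist G u v \<le> enat n"
  unfolding graph_dist_def using assms by (intro INF_lower) simp

text \<open>A common vertex gives a walk of length 0, an edge one of length 1.\<close>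

lemma crossings_eq_if_near:
  assumes dist: "\<And>c d. c \<in> crossings G \<Longrightarrow> d \<in> crossings G \<Longrightarrow> c \<noteq> d \<Longrightarrow> crossing_dist G c d \<ge> 2"
    and "c \<in> crossings G" "d \<in> crossings G" "u \<in> \<Union>c" "v \<in> \<Union>d"
    and near: "u = v \<or> {u, v} \<in> edges G"
  shows "c = d"
proof (rule ccontr)
  assume "c \<noteq> d"
  then have "2 \<le> crossing_dist G c d"
    using assms by blast
  also have "\<dots> \<le> graph_dist G u v"
    unfolding crossing_dist_def using assms by (meson INF_lower2 order_refl)
  finally have *: "2 \<le> graph_dist G u v" .
  have "(u, v) \<in> adj_rel G ^^ 0 \<or> (u, v) \<in> adj_rel G ^^ 1"
    using near by (auto simp: adj_rel_def)
  then have "graph_dist G u v \<le> enat 1"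
    using graph_dist_le[where u = u and v = v and G = G]
    by (metis enat_ord_simps(1) order_trans zero_le_one order_refl)
  with * have "2 \<le> enat 1"
    by (rule order_trans)
  then show False
    by (simp add: numeral_eq_enat)
qed

section \<open>Recolouring the crossings\<close>

lemma ex_proper_colouring:
  assumes "simple_graph G"
  shows "\<exists>c :: 'a \<Rightarrow> nat. c ` verts G \<subseteq> {..<chromatic_number G} \<and>
           (\<forall>u v. {u, v} \<in> edges G \<longrightarrow> c u \<noteq> c v)"
  unfolding chromatic_number_def
proof (rule LeastI_ex)
  have fin: "finite (verts G)" and edge: "\<And>e. e \<in> edges G \<Longrightarrow> e \<subseteq> verts G \<and> card e = 2"
    using assms by (auto simp: simple_graph_def)
  obtain c :: "'a \<Rightarrow> nat" and n where c: "c ` verts G = {i. i < n}" "inj_on c (verts G)"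
    using finite_imp_inj_to_nat_seg[OF fin] by metis
  have "c u \<noteq> c v" if "{u, v} \<in> edges G" for u v
  proof -
    have "u \<in> verts G" "v \<in> verts G" "u \<noteq> v"
      using edge[OF that] by auto
    with c(2) show ?thesis
      by (auto simp: inj_on_def)
  qed
  with c show "\<exists>k c. c ` verts G \<subseteq> {..<k} \<and> (\<forall>u v. {u, v} \<in> edges G \<longrightarrow> c u \<noteq> (c v :: nat))"
    by (intro exI[of _ n] exI[of _ c]) auto
qed

lemma crossing_edges_labelled:
  fixes c :: "'a \<Rightarrow> nat"
  assumes "simple_graph G" and c: "\<And>u v. {u, v} \<in> edges G \<Longrightarrow> c u \<noteq> c v"
    and "d \<in> crossings G"
  shows "\<exists>a b p q. d = {{a, b}, {p, q}} \<and> crosses G {a, b} {p, q} \<and> c b < c q"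
proof -
  obtain e e' where d: "d = {e, e'}" and cr: "crosses G e e'"
    using assms(3) by (auto simp: crossings_def)
  have E: "e \<in> edges G" "e' \<in> edges G"
    using cr by (auto simp: crosses_def)
  then obtain x y z w where e: "e = {x, y}" and e': "e' = {z, w}"
    using assms(1) by (metis simple_graph_def card_2_iff)
  \<comment> \<open>\<open>x\<close> and \<open>y\<close> have different colours, so one of them differs in colour from \<open>w\<close>\<close>
  have "c x \<noteq> c y"
    using c E e by blast
  then obtain x' y' where xy: "e = {x', y'}" "c y' \<noteq> c w"
    using e by (metis insert_commute)
  show ?thesis
  proof (cases "c y' < c w")
    case True
    then show ?thesis
      using d cr xy e' by blast
  next
    case False
    then have "c w < c y'"
      using xy(2) by simp
    moreover have "d = {{z, w}, {x', y'}}" "crosses G {z, w} {x', y'}"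
      using d cr xy(1) e' by (auto simp: crosses_commute)
    ultimately show ?thesis
      by blast
  qed
qed

text \<open>The choices made in different crossings do not interfere: a vertex of one crossing is
  neither a vertex of another nor adjacent to one. So each pair of crossing edges really becomes
  the pair of chords \<open>{0, c b + 2}\<close> and \<open>{1, c q + 2}\<close>.\<close>

lemma geometric_hom_convex_clique:
  fixes c :: "'a \<Rightarrow> nat"
  assumes G: "simple_graph G"
    and dist: "\<And>c d. c \<in> crossings G \<Longrightarrow> d \<in> crossings G \<Longrightarrow> c \<noteq> d \<Longrightarrow> crossing_dist G c d \<ge> 2"
    and ck: "c ` verts G \<subseteq> {..<k}"
    and c: "\<And>u v. {u, v} \<in> edges G \<Longrightarrow> c u \<noteq> c v"
  shows "\<exists>f. geometric_hom G (convex_clique (k + 2)) f"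
proof -
  have edge: "\<And>e. e \<in> edges G \<Longrightarrow> e \<subseteq> verts G \<and> card e = 2"
    using G by (auto simp: simple_graph_def)
  have "\<forall>d\<in>crossings G. \<exists>a b p q. d = {{a, b}, {p, q}} \<and> crosses G {a, b} {p, q} \<and> c b < c q"
    using crossing_edges_labelled[OF G, of c] c by blast
  then obtain a b p q where lab: "\<And>d. d \<in> crossings G \<Longrightarrow> d = {{a d, b d}, {p d, q d}}"
    and cr: "\<And>d. d \<in> crossings G \<Longrightarrow> crosses G {a d, b d} {p d, q d}"
    and less: "\<And>d. d \<in> crossings G \<Longrightarrow> c (b d) < c (q d)"
    by metis
  have mem: "a d \<in> \<Union>d" "b d \<in> \<Union>d" "p d \<in> \<Union>d" "q d \<in> \<Union>d" if "d \<in> crossings G" for d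
    using lab[OF that] by blast+
  have neq: "a d \<noteq> b d" "a d \<noteq> p d" "a d \<noteq> q d" "b d \<noteq> p d" "p d \<noteq> q d"
    if "d \<in> crossings G" for d
  proof -
    have E: "{a d, b d} \<in> edges G" "{p d, q d} \<in> edges G" and "{a d, b d} \<inter> {p d, q d} = {}"
      using cr[OF that] by (simp_all add: crosses_def)
    then show "a d \<noteq> p d" "a d \<noteq> q d" "b d \<noteq> p d"
      by auto
    show "a d \<noteq> b d" "p d \<noteq> q d"
      using c[OF E(1)] c[OF E(2)] by force+
  qed
  note same = crossings_eq_if_near[OF dist]
  define A where "A = a ` crossings G"
  define B where "B = p ` crossings G"
  define f where "f v = (if v \<in> A then 0 else if v \<in> B then 1 else c v + 2)" for v
  have A_indep: "{u, v} \<notin> edges G" if uA: "u \<in> A" "v \<in> A" for u v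
  proof
    assume uv: "{u, v} \<in> edges G"
    obtain d d' where d: "d \<in> crossings G" "u = a d" "d' \<in> crossings G" "v = a d'"
      using uA by (auto simp: A_def)
    then have "d = d'"
      using same[of d d' u v] mem(1) uv by simp
    then show False
      using d c[OF uv] by simp
  qed
  have B_indep: "{u, v} \<notin> edges G" if uB: "u \<in> B" "v \<in> B" for u v
  proof
    assume uv: "{u, v} \<in> edges G"
    obtain d d' where d: "d \<in> crossings G" "u = p d" "d' \<in> crossings G" "v = p d'"
      using uB by (auto simp: B_def)
    then have "d = d'"
      using same[of d d' u v] mem(3) uv by simp
    then show False
      using d c[OF uv] by simp
  qed
  have f_less: "f v < k + 2" if "v \<in> verts G" for v
    using ck that by (auto simp: f_def)
  have f_edge: "{f u, f v} \<in> edges (convex_clique (k + 2))" if uv: "{u, v} \<in> edges G" for u v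
  proof -
    have "f u \<noteq> f v"
      using A_indep[of u v] B_indep[of u v] c[OF uv] uv by (auto simp: f_def)
    moreover have "f u < k + 2" "f v < k + 2"
      using edge[OF uv] f_less by blast+
    ultimately show ?thesis
      by (intro edges_convex_clique)
  qed
  have f_cross: "crosses (convex_clique (k + 2)) (f ` e) (f ` e')" if e: "crosses G e e'" for e e'
  proof -
    define d where "d = {e, e'}"
    have d: "d \<in> crossings G"
      using e by (auto simp: d_def crossings_def)
    have A: "x = a d" if "x \<in> \<Union>d" "x \<in> A" for x
    proof -
      obtain d' where d': "d' \<in> crossings G" "x = a d'"
        using \<open>x \<in> A\<close> unfolding A_def by blast
      have "d' = d"
        using same[of d' d x x] d d' mem(1)[of d'] \<open>x \<in> \<Union>d\<close> by simp
      then show ?thesis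
        using d' by simp
    qed
    have B: "x = p d" if "x \<in> \<Union>d" "x \<in> B" for x
    proof -
      obtain d' where d': "d' \<in> crossings G" "x = p d'"
        using \<open>x \<in> B\<close> unfolding B_def by blast
      have "d' = d"
        using same[of d' d x x] d d' mem(3)[of d'] \<open>x \<in> \<Union>d\<close> by simp
      then show ?thesis
        using d' by simp
    qed
    have "a d \<in> A" "p d \<in> B"
      using d by (auto simp: A_def B_def)
    moreover have "b d \<notin> A" "b d \<notin> B" "p d \<notin> A" "q d \<notin> A" "q d \<notin> B"
      using A B mem[OF d] neq[OF d] by metis+
    ultimately have f: "f (a d) = 0" "f (b d) = c (b d) + 2" "f (p d) = 1" "f (q d) = c (q d) + 2"
      by (simp_all add: f_def)
    have "q d \<in> verts G"
      using cr[OF d] edge by (auto simp: crosses_def)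
    then have "c (q d) < k"
      using ck by auto
    then have X: "crosses (convex_clique (k + 2)) (f ` {a d, b d}) (f ` {p d, q d})"
      using less[OF d] by (simp add: f crosses_convex_clique)
    have "{e, e'} = {{a d, b d}, {p d, q d}}"
      using lab[OF d] by (simp add: d_def)
    then consider "e = {a d, b d}" "e' = {p d, q d}" | "e = {p d, q d}" "e' = {a d, b d}"
      by (auto simp: doubleton_eq_iff)
    then show ?thesis
      using X crosses_commute by cases blast+
  qed
  have "geometric_hom G (convex_clique (k + 2)) f"
    unfolding geometric_hom_def using f_less f_edge f_cross
    by (simp add: image_subset_iff del: convex_clique_simps(2))
  then show ?thesis
    by blast
qed

theorem theorem3:
  fixes G :: "'a geom_graph"
  assumes "geometric_graph G"
    and "\<And>c d. c \<in> crossings G \<Longrightarrow> d \<in> crossings G \<Longrightarrow> c \<noteq> d \<Longrightarrow> crossing_dist G c d \<ge> 2"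
  shows "geochromatic_number G \<le> chromatic_number G + 2"
proof -
  have G: "simple_graph G"
    using assms(1) by (simp add: geometric_graph_def)
  obtain c :: "'a \<Rightarrow> nat" where "c ` verts G \<subseteq> {..<chromatic_number G}"
    and "\<And>u v. {u, v} \<in> edges G \<Longrightarrow> c u \<noteq> c v"
    using ex_proper_colouring[OF G] by blast
  then have "\<exists>f. geometric_hom G (convex_clique (chromatic_number G + 2)) f"
    using geometric_hom_convex_clique[OF G assms(2)] by blast
  then show ?thesis
    unfolding geochromatic_number_def
    using geometric_clique_convex_clique by (intro Least_le) auto
qed

end
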